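(* Let $G\subset\mathbb{R}^3$ be a bounded domain with smooth boundary $\Gamma$ and let $\lambda\neq0$. The (formally overdetermined) boundary value problem $$\nabla\,\mathrm{div}\,\mathbf{u}+\lambda\mathbf{u}=\mathbf{f},\quad \lambda\,\mathrm{rot}\,\mathbf{u}=\mathrm{rot}\,\mathbf{f}\ \text{ in } G,\qquad \mathbf{n}\cdot\mathbf{u}|_\Gamma=g$$ is elliptic in the sense of Solonnikov, that is, both of the following conditions hold: ($1^0$) for every $\xi\in\mathbb{R}^3\setminus\{0\}$ the system of linear algebraic equations $$\lambda\,\mathrm{rot}(i\xi)\mathbf{w}=0,\qquad (\nabla\,\mathrm{div})(i\xi)\mathbf{w}=0$$ for $\mathbf{w}\in\mathbb{C}^3$ has only the trivial solution $\mathbf{w}=0$; ($2^0$) for every point $y\in\Gamma$ with unit normal vector $\mathbf{n}=\mathbf{n}(y)$ to $\Gamma$ and every tangent vector $\tau\neq0$ to $\Gamma$ at $y$, the system of linear ordinary differential equations on the half-line $z\ge0$ $$\lambda\,\mathrm{rot}\big(i\tau+\mathbf{n}\,d/dz\big)\mathbf{v}=0,\qquad (\nabla\,\mathrm{div})\big(i\tau+\mathbf{n}\,d/dz\big)\mathbf{v}=0$$ with the conditions $\mathbf{n}\cdot\mathbf{v}|_{z=0}=0$ and $\mathbf{v}(z)\to0$ as $z\to+\infty$ has only the trivial solution $\mathbf{v}=0$.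
   Context: $\mathrm{rot}(\cdot)$ and $(\nabla\,\mathrm{div})(\cdot)$ denote the matrix symbols of the operators curl and gradient of divergence, obtained by replacing the vector $\nabla=(\partial_1,\partial_2,\partial_3)$ with the given vector: $\mathrm{rot}(\zeta)\mathbf{w}=\zeta\times\mathbf{w}$ and $(\nabla\,\mathrm{div})(\zeta)\mathbf{w}=\zeta\,(\zeta\cdot\mathbf{w})$, where $\zeta\cdot\mathbf{w}=\sum_j\zeta_jw_j$ is bilinear. For $\zeta=i\tau+\mathbf{n}\,d/dz$ the components of $\zeta$ are ordinary differential operators in $z$ acting on $\mathbf{v}:[0,\infty)\to\mathbb{C}^3$. *)

theory Defs
  imports "HOL-Analysis.Analysis" "HOL-Library.Function_Algebras"
begin

text \<open>Intended for open \<open>U\<close> only, since the derivatives are two-sided.\<close>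

primrec Ck_on :: "nat \<Rightarrow> 'a set \<Rightarrow> ('a::euclidean_space \<Rightarrow> 'b::real_normed_vector) \<Rightarrow> bool" where
  "Ck_on 0 U f \<longleftrightarrow> continuous_on U f"
| "Ck_on (Suc k) U f \<longleftrightarrow>
     (\<forall>x\<in>U. f differentiable (at x)) \<and>
     (\<forall>b\<in>Basis. Ck_on k U (\<lambda>x. frechet_derivative f (at x) b))"

definition smooth_on :: "'a set \<Rightarrow> ('a::euclidean_space \<Rightarrow> 'b::real_normed_vector) \<Rightarrow> bool" where
  "smooth_on U f \<longleftrightarrow> (\<forall>k. Ck_on k U f)"

definition smooth_boundary :: "(real^3) set \<Rightarrow> bool" where
  "smooth_boundary G \<longleftrightarrow>
     (\<forall>y\<in>frontier G. \<exists>U (\<rho> :: real^3 \<Rightarrow> real).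
        open U \<and> y \<in> U \<and> smooth_on U \<rho> \<and>
        (\<forall>x\<in>U. frechet_derivative \<rho> (at x) \<noteq> (\<lambda>h. 0)) \<and>
        G \<inter> U = {x \<in> U. \<rho> x < 0})"

definition smooth_bounded_domain :: "(real^3) set \<Rightarrow> bool" where
  "smooth_bounded_domain G \<longleftrightarrow>
     open G \<and> connected G \<and> G \<noteq> {} \<and> bounded G \<and> smooth_boundary G"

definition tangent_space :: "(real^3) set \<Rightarrow> real^3 \<Rightarrow> (real^3) set" where
  "tangent_space \<Gamma> y =
     {\<tau>. \<exists>(\<gamma> :: real \<Rightarrow> real^3) \<epsilon>. \<epsilon> > 0 \<and> smooth_on {-\<epsilon><..<\<epsilon>} \<gamma> \<and>
        \<gamma> ` {-\<epsilon><..<\<epsilon>} \<subseteq> \<Gamma> \<and> \<gamma> 0 = y \<and> (\<gamma> has_vector_derivative \<tau>) (at 0)}"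

text \<open>Both orientations of the normal are included.\<close>

definition unit_normals :: "(real^3) set \<Rightarrow> real^3 \<Rightarrow> (real^3) set" where
  "unit_normals \<Gamma> y = {n. norm n = 1 \<and> (\<forall>\<tau>\<in>tangent_space \<Gamma> y. n \<bullet> \<tau> = 0)}"

text \<open>
  The symbols \<open>rot(\<zeta>)\<close> and \<open>(\<nabla> div)(\<zeta>)\<close>, for a vector \<open>\<zeta>\<close> whose three components are
  operators on an additive group. Numerical vectors \<open>\<zeta>\<close> act by multiplication on the
  complex numbers; \<open>\<zeta> = i\<tau> + n d/dz\<close> acts on functions of \<open>z\<close> (with pointwise addition).
\<close>

definition rot_symbol :: "('a::ab_group_add \<Rightarrow> 'a)^3 \<Rightarrow> 'a^3 \<Rightarrow> 'a^3" where
  "rot_symbol \<zeta> w =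
     vector [(\<zeta>$2) (w$3) - (\<zeta>$3) (w$2),
             (\<zeta>$3) (w$1) - (\<zeta>$1) (w$3),
             (\<zeta>$1) (w$2) - (\<zeta>$2) (w$1)]"

definition grad_div_symbol :: "('a::ab_group_add \<Rightarrow> 'a)^3 \<Rightarrow> 'a^3 \<Rightarrow> 'a^3" where
  "grad_div_symbol \<zeta> w = (\<chi> k. (\<zeta>$k) (\<Sum>j\<in>UNIV. (\<zeta>$j) (w$j)))"

definition fourier_vec :: "real^3 \<Rightarrow> (complex \<Rightarrow> complex)^3" where
  "fourier_vec \<xi> = (\<chi> j. (\<lambda>c. \<i> * of_real (\<xi>$j) * c))"

text \<open>Derivative on the half-line, one-sided at \<open>0\<close>.\<close>

definition ddz :: "(real \<Rightarrow> 'b::real_normed_vector) \<Rightarrow> real \<Rightarrow> 'b" where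
  "ddz f z = vector_derivative f (at z within {0..})"

definition half_line_vec :: "real^3 \<Rightarrow> real^3 \<Rightarrow> ((real \<Rightarrow> complex) \<Rightarrow> (real \<Rightarrow> complex))^3" where
  "half_line_vec \<tau> n =
     (\<chi> j. (\<lambda>f z. \<i> * of_real (\<tau>$j) * f z + of_real (n$j) * ddz f z))"

definition components :: "(real \<Rightarrow> complex^3) \<Rightarrow> (real \<Rightarrow> complex)^3" where
  "components v = (\<chi> j. (\<lambda>z. v z $ j))"

definition twice_differentiable_half_line :: "(real \<Rightarrow> complex^3) \<Rightarrow> bool" where
  "twice_differentiable_half_line v \<longleftrightarrow>
     (\<forall>z\<ge>0. v differentiable (at z within {0..})) \<and>
     (\<forall>z\<ge>0. ddz v differentiable (at z within {0..}))"

text \<open>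
  Ellipticity in the sense of Solonnikov of the boundary value problem
  \<open>\<nabla> div u + \<lambda> u = f\<close>, \<open>\<lambda> rot u = rot f\<close> in \<open>G\<close>, \<open>n \<cdot> u = g\<close> on the boundary, with \<open>\<lambda> = l\<close>.
  Only the principal parts \<open>\<nabla> div\<close> and \<open>\<lambda> rot\<close> and the homogeneous boundary condition enter.
\<close>

definition solonnikov_interior :: "complex \<Rightarrow> bool" where
  "solonnikov_interior l \<longleftrightarrow>
     (\<forall>\<xi> :: real^3. \<xi> \<noteq> 0 \<longrightarrow>
       (\<forall>w :: complex^3.
          (\<forall>k. l * rot_symbol (fourier_vec \<xi>) w $ k = 0) \<and>
          (\<forall>k. grad_div_symbol (fourier_vec \<xi>) w $ k = 0)
          \<longrightarrow> w = 0))"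

definition solonnikov_boundary :: "complex \<Rightarrow> (real^3) set \<Rightarrow> bool" where
  "solonnikov_boundary l \<Gamma> \<longleftrightarrow>
     (\<forall>y\<in>\<Gamma>. \<forall>n\<in>unit_normals \<Gamma> y. \<forall>\<tau>\<in>tangent_space \<Gamma> y. \<tau> \<noteq> 0 \<longrightarrow>
       (\<forall>v :: real \<Rightarrow> complex^3.
          twice_differentiable_half_line v \<and>
          (\<forall>z\<ge>0. \<forall>k. l * (rot_symbol (half_line_vec \<tau> n) (components v) $ k) z = 0) \<and>
          (\<forall>z\<ge>0. \<forall>k. (grad_div_symbol (half_line_vec \<tau> n) (components v) $ k) z = 0) \<and>
          (\<Sum>j\<in>UNIV. of_real (n$j) * v 0 $ j) = 0 \<and>
          (v \<longlongrightarrow> 0) at_top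
          \<longrightarrow> (\<forall>z\<ge>0. v z = 0)))"

definition solonnikov_elliptic :: "complex \<Rightarrow> (real^3) set \<Rightarrow> bool" where
  "solonnikov_elliptic l G \<longleftrightarrow> solonnikov_interior l \<and> solonnikov_boundary l (frontier G)"

end

theory Submission imports Defs begin

text \<open>
  Both conditions rest on the identity \<open>a \<times> (a \<times> w) = (a \<cdot> w) a - (a \<cdot> a) w\<close> for the bilinear
  products on \<open>\<complex>\<^sup>3\<close>: a vector \<open>w\<close> that is both parallel and orthogonal to a vector \<open>a\<close> with
  \<open>a \<cdot> a \<noteq> 0\<close> must vanish (\<open>cross_dot_zero_imp_zero\<close>).

  The interior condition is this fact for \<open>a = \<xi>\<close>: the symbol of the gradient of divergence gives
  \<open>\<xi> \<cdot> w = 0\<close>, that of curl gives \<open>\<xi> \<times> w = 0\<close>, and \<open>\<xi> \<cdot> \<xi> = |\<xi>|\<^sup>2 > 0\<close> because \<open>\<xi>\<close> is real.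

  In the boundary condition \<open>n \<cdot> n = 1\<close>, \<open>n \<cdot> \<tau> = 0\<close> and \<open>\<tau> \<noteq> 0\<close>. Put \<open>p = n \<cdot> v\<close> and
  \<open>q = \<tau> \<cdot> v\<close>. The second system is \<open>i D \<tau> + D' n = 0\<close> for \<open>D = i q + p'\<close>; its component along \<open>\<tau>\<close>
  is \<open>i |\<tau>|\<^sup>2 D = 0\<close>, so \<open>p' = - i q\<close>. The first system is \<open>i \<tau> \<times> v + n \<times> v' = 0\<close>; its component
  along \<open>n\<close> says \<open>(n \<times> \<tau>) \<cdot> v = 0\<close>, and its component along \<open>n \<times> \<tau>\<close> says \<open>q' = i |\<tau>|\<^sup>2 p\<close>.
  The resulting linear system for \<open>(p, q)\<close> has the eigenvalues \<open>|\<tau>|\<close> and \<open>-|\<tau>|\<close>, with eigenmodes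
  \<open>|\<tau>| p - i q\<close> and \<open>|\<tau>| p + i q\<close>. Decay at infinity kills the growing mode; together with
  \<open>p(0) = 0\<close> this gives \<open>q(0) = 0\<close>, so the decaying mode vanishes as well
  (\<open>decaying_solution_zero\<close>). Thus \<open>(n \<times> \<tau>) \<times> v = p \<tau> - q n = 0\<close> and
  \<open>(n \<times> \<tau>) \<cdot> v = 0\<close>, and \<open>v\<close> vanishes by the first paragraph with \<open>a = n \<times> \<tau>\<close>, for which
  \<open>a \<cdot> a = |\<tau>|\<^sup>2\<close>.
\<close>

section \<open>Bilinear vector algebra\<close>

text \<open>
  The inner product on \<open>\<complex>\<^sup>3\<close> as a Euclidean space is the real part of the Hermitian one, whereas
  the symbols are bilinear; hence products over an arbitrary commutative ring.
\<close>

definition bdot :: "'a::comm_ring_1^3 \<Rightarrow> 'a^3 \<Rightarrow> 'a" where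
  "bdot a b = (\<Sum>j\<in>UNIV. a$j * b$j)"

definition bcross :: "'a::comm_ring_1^3 \<Rightarrow> 'a^3 \<Rightarrow> 'a^3" where
  "bcross a b =
     vector [a$2 * b$3 - a$3 * b$2, a$3 * b$1 - a$1 * b$3, a$1 * b$2 - a$2 * b$1]"

definition cvec :: "real^3 \<Rightarrow> complex^3" where
  "cvec a = (\<chi> j. of_real (a$j))"

lemma bcross_bcross: "bcross a (bcross b c) = bdot a c *s b - bdot a b *s c"
  by (simp add: vec_eq_iff forall_3 bdot_def bcross_def sum_3 algebra_simps)

lemma bcross_bcross_left: "bcross (bcross a b) c = bdot a c *s b - bdot b c *s a"
  by (simp add: vec_eq_iff forall_3 bdot_def bcross_def sum_3 algebra_simps)

lemma bdot_bcross_bcross: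
  "bdot (bcross a b) (bcross c d) = bdot a c * bdot b d - bdot a d * bdot b c"
  by (simp add: bdot_def bcross_def sum_3 algebra_simps)

lemma bdot_bcross_rotate: "bdot a (bcross b c) = bdot (bcross a b) c"
  by (simp add: bdot_def bcross_def sum_3 algebra_simps)

lemma bdot_bcross_self: "bdot a (bcross a b) = 0"
  by (simp add: bdot_def bcross_def sum_3 algebra_simps)

lemma bdot_right_linear:
  "bdot a (b + c) = bdot a b + bdot a c" "bdot a (r *s b) = r * bdot a b" "bdot a 0 = 0"
  by (simp_all add: bdot_def sum_3 algebra_simps)

lemma cross_dot_zero_imp_zero:
  fixes a w :: "'a::field^3"
  assumes "bcross a w = 0" "bdot a w = 0" "bdot a a \<noteq> 0"
  shows "w = 0"
proof -
  have "bcross a (bcross a w) = 0"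
    using assms(1) by (simp add: vec_eq_iff forall_3 bcross_def)
  then have "bdot a a *s w = 0"
    using assms(2) by (simp add: bcross_bcross vec_eq_iff)
  then show ?thesis
    using assms(3) by (simp add: vec_eq_iff)
qed

lemma bdot_cvec_cvec: "bdot (cvec a) (cvec b) = of_real (a \<bullet> b)"
  by (simp add: bdot_def cvec_def inner_vec_def sum_3)

section \<open>The interior condition\<close>

lemma rot_symbol_fourier: "rot_symbol (fourier_vec \<xi>) w = \<i> *s bcross (cvec \<xi>) w"
  by (simp add: vec_eq_iff forall_3 rot_symbol_def fourier_vec_def bcross_def cvec_def algebra_simps)

lemma grad_div_symbol_fourier:
  "grad_div_symbol (fourier_vec \<xi>) w = (- bdot (cvec \<xi>) w) *s cvec \<xi>"
  by (simp add: vec_eq_iff forall_3 grad_div_symbol_def fourier_vec_def bdot_def cvec_def sum_3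
      algebra_simps)

lemma solonnikov_interior_nonzero:
  assumes "l \<noteq> 0"
  shows "solonnikov_interior l"
  unfolding solonnikov_interior_def
proof (intro allI impI, elim conjE)
  fix \<xi> :: "real^3" and w :: "complex^3"
  assume \<xi>: "\<xi> \<noteq> 0"
    and rot: "\<forall>k. l * rot_symbol (fourier_vec \<xi>) w $ k = 0"
    and grad_div: "\<forall>k. grad_div_symbol (fourier_vec \<xi>) w $ k = 0"
  have "bcross (cvec \<xi>) w = 0"
    using rot assms by (simp add: rot_symbol_fourier vec_eq_iff)
  moreover have "bdot (cvec \<xi>) w = 0"
    using grad_div \<xi> by (auto simp: grad_div_symbol_fourier cvec_def vec_eq_iff)
  moreover have "bdot (cvec \<xi>) (cvec \<xi>) \<noteq> 0"
    using \<xi> by (simp add: bdot_cvec_cvec)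
  ultimately show "w = 0"
    by (rule cross_dot_zero_imp_zero)
qed

section \<open>Linear differential equations on the half-line\<close>

lemma exponential_solution:
  fixes f :: "real \<Rightarrow> complex" and \<mu> :: real
  assumes "\<And>z. z \<ge> 0 \<Longrightarrow> (f has_vector_derivative of_real \<mu> * f z) (at z within {0..})"
    and "z \<ge> 0"
  shows "f z = of_real (exp (\<mu> * z)) * f 0"
proof -
  define h where "h x = exp (- \<mu> * x) *\<^sub>R f x" for x
  have "(h has_vector_derivative 0) (at x within {0..})" if "x \<in> {0..}" for x
  proof -
    have "((\<lambda>x. exp (- \<mu> * x)) has_real_derivative exp (- \<mu> * x) * - \<mu>) (at x within {0..})"
      by (auto intro!: derivative_eq_intros)
    moreover have "(f has_vector_derivative of_real \<mu> * f x) (at x within {0..})"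
      using assms(1) that by simp
    ultimately show ?thesis
      unfolding h_def
      by (rule has_vector_derivative_scaleR[THEN has_vector_derivative_eq_rhs])
        (simp add: scaleR_conv_of_real)
  qed
  then obtain c where c: "\<And>x. x \<in> {0..} \<Longrightarrow> h x = c"
    using has_vector_derivative_zero_constant[of "{0..}" h] by (auto simp: convex_real_interval)
  have "h z = h 0"
    using c assms(2) by simp
  then have "of_real (exp (\<mu> * z)) * (exp (- \<mu> * z) *\<^sub>R f z) = of_real (exp (\<mu> * z)) * f 0"
    by (simp add: h_def)
  then show ?thesis
    by (simp add: scaleR_conv_of_real exp_minus flip: mult.assoc of_real_mult)
qed

text \<open>
  \<open>t p - i q\<close> and \<open>t p + i q\<close> are the modes of the system, with exponents \<open>t\<close> and \<open>-t\<close>.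
\<close>

lemma decaying_solution_zero:
  fixes p q :: "real \<Rightarrow> complex" and t :: real
  assumes t: "t > 0"
    and p: "\<And>z. z \<ge> 0 \<Longrightarrow> (p has_vector_derivative - \<i> * q z) (at z within {0..})"
    and q: "\<And>z. z \<ge> 0 \<Longrightarrow> (q has_vector_derivative \<i> * of_real (t\<^sup>2) * p z) (at z within {0..})"
    and lim: "(p \<longlongrightarrow> 0) at_top" "(q \<longlongrightarrow> 0) at_top"
    and p0: "p 0 = 0"
    and z: "z \<ge> 0"
  shows "p z = 0" "q z = 0"
proof -
  define g where "g x = of_real t * p x - \<i> * q x" for x
  define d where "d x = of_real t * p x + \<i> * q x" for x
  have growing: "g x = of_real (exp (t * x)) * g 0" if "x \<ge> 0" for x
  proof (rule exponential_solution[OF _ that])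
    fix y :: real
    assume "y \<ge> 0"
    then show "(g has_vector_derivative of_real t * g y) (at y within {0..})"
      unfolding g_def
      by (auto intro!: derivative_eq_intros p q simp: algebra_simps power2_eq_square)
  qed
  have decaying: "d x = of_real (exp (- t * x)) * d 0" if "x \<ge> 0" for x
  proof (rule exponential_solution[OF _ that])
    fix y :: real
    assume "y \<ge> 0"
    then show "(d has_vector_derivative of_real (- t) * d y) (at y within {0..})"
      unfolding d_def
      by (auto intro!: derivative_eq_intros p q simp: algebra_simps power2_eq_square)
  qed
  have "(g \<longlongrightarrow> 0) at_top"
    unfolding g_def using lim by (auto intro!: tendsto_eq_intros)
  then have "((\<lambda>x. norm (g x)) \<longlongrightarrow> 0) at_top"
    by (rule tendsto_norm_zero)
  moreover have "\<forall>\<^sub>F x in at_top. norm (g 0) \<le> norm (g x)"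
    using eventually_ge_at_top[of 0]
  proof eventually_elim
    case (elim x)
    then have "1 * norm (g 0) \<le> exp (t * x) * norm (g 0)"
      using t by (intro mult_right_mono) auto
    then show ?case
      using growing[OF elim] by (simp add: norm_mult)
  qed
  ultimately have "norm (g 0) \<le> 0"
    by (intro tendsto_lowerbound) auto
  then have g0: "g 0 = 0"
    by simp
  then have "d 0 = 0"
    using p0 by (simp add: g_def d_def)
  then have "g z = 0" "d z = 0"
    using growing[OF z] decaying[OF z] g0 by simp_all
  moreover have "g z + d z = 2 * of_real t * p z" "d z - g z = 2 * \<i> * q z"
    by (simp_all add: g_def d_def)
  ultimately show "p z = 0" "q z = 0"
    using t by simp_all
qed

section \<open>The boundary condition\<close>

lemma has_vector_derivative_ddz:
  assumes "f differentiable (at z within {0..})"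
  shows "(f has_vector_derivative ddz f z) (at z within {0..})"
  using assms unfolding ddz_def by (simp add: vector_derivative_works)

lemma ddz_eq:
  assumes "(f has_vector_derivative f') (at z within {0..})" "z \<ge> 0"
  shows "ddz f z = f'"
proof -
  have "z islimpt {0..z + 1}"
    using assms(2) by simp
  then have "z islimpt {0..}"
    by (rule islimpt_subset) auto
  then show ?thesis
    using assms(1) unfolding ddz_def
    by (intro vector_derivative_within) (simp_all add: trivial_limit_within)
qed

lemma ddz_component:
  fixes v :: "real \<Rightarrow> complex^3"
  assumes "v differentiable (at z within {0..})" "z \<ge> 0"
  shows "ddz (\<lambda>x. v x $ j) z = ddz v z $ j"
  using assms
  by (intro ddz_eq bounded_linear.has_vector_derivative[OF bounded_linear_vec_nth]
      has_vector_derivative_ddz)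

lemma rot_symbol_half_line:
  assumes "v differentiable (at z within {0..})" "z \<ge> 0"
  shows "(\<chi> k. (rot_symbol (half_line_vec \<tau> n) (components v) $ k) z) =
    \<i> *s bcross (cvec \<tau>) (v z) + bcross (cvec n) (ddz v z)"
  by (simp add: vec_eq_iff forall_3 rot_symbol_def half_line_vec_def components_def bcross_def
      cvec_def ddz_component[OF assms] algebra_simps)

text \<open>
  The coefficient \<open>D'\<close> of \<open>n\<close> involves second derivatives of \<open>v\<close>; it is left unspecified because
  the product with \<open>\<tau>\<close> annihilates it.
\<close>

lemma grad_div_symbol_half_line:
  assumes "v differentiable (at z within {0..})" "z \<ge> 0"
  obtains D' where "(\<chi> k. (grad_div_symbol (half_line_vec \<tau> n) (components v) $ k) z) =
    (\<i> * (\<i> * bdot (cvec \<tau>) (v z) + bdot (cvec n) (ddz v z))) *s cvec \<tau> + D' *s cvec n"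
proof -
  define D where "D = (\<Sum>j\<in>UNIV. (half_line_vec \<tau> n $ j) (components v $ j))"
  have "D z = \<i> * bdot (cvec \<tau>) (v z) + bdot (cvec n) (ddz v z)"
    by (simp add: D_def sum_3 half_line_vec_def components_def bdot_def cvec_def
        ddz_component[OF assms] algebra_simps)
  moreover have "(\<chi> k. (grad_div_symbol (half_line_vec \<tau> n) (components v) $ k) z) =
    (\<i> * D z) *s cvec \<tau> + ddz D z *s cvec n"
    unfolding grad_div_symbol_def D_def[symmetric]
    by (simp add: vec_eq_iff half_line_vec_def cvec_def algebra_simps)
  ultimately show thesis
    using that by metis
qed

text \<open>
  The vectors \<open>n\<close>, \<open>\<tau>\<close> and \<open>n \<times> \<tau>\<close> form an orthogonal basis; these are the components of the two
  systems along it that determine \<open>v\<close>.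
\<close>

lemma half_line_system_components:
  assumes diff: "v differentiable (at z within {0..})" and z: "z \<ge> 0"
    and n: "n \<bullet> n = 1" and orth: "n \<bullet> \<tau> = 0" and \<tau>: "\<tau> \<noteq> 0"
    and rot: "\<forall>k. (rot_symbol (half_line_vec \<tau> n) (components v) $ k) z = 0"
    and grad_div: "\<forall>k. (grad_div_symbol (half_line_vec \<tau> n) (components v) $ k) z = 0"
  shows "bdot (cvec n) (ddz v z) = - \<i> * bdot (cvec \<tau>) (v z)"
    and "bdot (cvec \<tau>) (ddz v z) = \<i> * of_real ((norm \<tau>)\<^sup>2) * bdot (cvec n) (v z)"
    and "bdot (bcross (cvec n) (cvec \<tau>)) (v z) = 0"
proof -
  define N T w w' where "N = cvec n" and "T = cvec \<tau>" and "w = v z" and "w' = ddz v z"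
  have NN: "bdot N N = 1" and NT: "bdot N T = 0" "bdot T N = 0"
    and TT: "bdot T T = of_real ((norm \<tau>)\<^sup>2)" "bdot T T \<noteq> 0"
    using n orth \<tau> by (simp_all add: N_def T_def bdot_cvec_cvec dot_square_norm inner_commute)
  have rot': "\<i> *s bcross T w + bcross N w' = 0"
    using rot rot_symbol_half_line[OF diff z, of \<tau> n]
    by (simp add: N_def T_def w_def w'_def vec_eq_iff)
  obtain D' where "(\<chi> k. (grad_div_symbol (half_line_vec \<tau> n) (components v) $ k) z) =
      (\<i> * (\<i> * bdot T w + bdot N w')) *s T + D' *s N"
    unfolding N_def T_def w_def w'_def by (rule grad_div_symbol_half_line[OF diff z])
  then have "(\<i> * (\<i> * bdot T w + bdot N w')) *s T + D' *s N = 0"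
    using grad_div by (simp add: vec_eq_iff)
  then have "bdot T ((\<i> * (\<i> * bdot T w + bdot N w')) *s T + D' *s N) = 0"
    by (simp add: bdot_right_linear)
  then have "\<i> * bdot T w + bdot N w' = 0"
    using NT TT(2) by (simp add: bdot_right_linear)
  then show "bdot (cvec n) (ddz v z) = - \<i> * bdot (cvec \<tau>) (v z)"
    by (simp add: N_def T_def w_def w'_def add_eq_0_iff)
  have "bdot (bcross N T) (\<i> *s bcross T w + bcross N w') = 0"
    using rot' by (simp add: bdot_right_linear)
  then have "bdot T w' = \<i> * bdot T T * bdot N w"
    using NN NT by (simp add: bdot_right_linear bdot_bcross_bcross)
  then show "bdot (cvec \<tau>) (ddz v z) = \<i> * of_real ((norm \<tau>)\<^sup>2) * bdot (cvec n) (v z)"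
    using TT(1) by (simp add: N_def T_def w_def w'_def)
  have "bdot N (\<i> *s bcross T w + bcross N w') = 0"
    using rot' by (simp add: bdot_right_linear)
  then show "bdot (bcross (cvec n) (cvec \<tau>)) (v z) = 0"
    by (simp add: bdot_right_linear bdot_bcross_self bdot_bcross_rotate N_def T_def w_def)
qed

lemma bounded_linear_bdot: "bounded_linear (bdot (a :: complex^3))"
  unfolding bdot_def
  by (intro bounded_linear_sum bounded_linear_const_mult bounded_linear_vec_nth)

lemma solonnikov_boundary_nonzero:
  assumes "l \<noteq> 0"
  shows "solonnikov_boundary l \<Gamma>"
  unfolding solonnikov_boundary_def
proof (intro ballI impI allI, elim conjE)
  fix y n \<tau> :: "real^3" and v :: "real \<Rightarrow> complex^3" and z :: real
  assume unit_normal: "n \<in> unit_normals \<Gamma> y" and tangent: "\<tau> \<in> tangent_space \<Gamma> y"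
    and \<tau>: "\<tau> \<noteq> 0"
    and diff2: "twice_differentiable_half_line v"
    and rot: "\<forall>z\<ge>0. \<forall>k. l * (rot_symbol (half_line_vec \<tau> n) (components v) $ k) z = 0"
    and grad_div: "\<forall>z\<ge>0. \<forall>k. (grad_div_symbol (half_line_vec \<tau> n) (components v) $ k) z = 0"
    and v0: "(\<Sum>j\<in>UNIV. of_real (n$j) * v 0 $ j) = 0"
    and lim: "(v \<longlongrightarrow> 0) at_top"
    and z: "0 \<le> z"
  have n: "n \<bullet> n = 1" and orth: "n \<bullet> \<tau> = 0"
    using unit_normal tangent by (auto simp: unit_normals_def dot_square_norm)
  define p q where "p x = bdot (cvec n) (v x)" and "q x = bdot (cvec \<tau>) (v x)" for x
  have diff: "v differentiable (at x within {0..})" if "x \<ge> 0" for x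
    using diff2 that by (simp add: twice_differentiable_half_line_def)
  have bdot_deriv: "((\<lambda>x. bdot a (v x)) has_vector_derivative bdot a (ddz v x)) (at x within {0..})"
    if "x \<ge> 0" for a x
    by (intro bounded_linear.has_vector_derivative[OF bounded_linear_bdot]
        has_vector_derivative_ddz diff that)
  have bdot_lim: "((\<lambda>x. bdot a (v x)) \<longlongrightarrow> 0) at_top" for a
    using bounded_linear.tendsto[OF bounded_linear_bdot lim] by (simp add: bdot_right_linear)
  have comps: "bdot (cvec n) (ddz v x) = - \<i> * q x"
      "bdot (cvec \<tau>) (ddz v x) = \<i> * of_real ((norm \<tau>)\<^sup>2) * p x"
      "bdot (bcross (cvec n) (cvec \<tau>)) (v x) = 0" if "x \<ge> 0" for x
    using half_line_system_components[OF diff[OF that] that n orth \<tau>] rot grad_div that assms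
    by (simp_all add: p_def q_def)
  have "(p has_vector_derivative - \<i> * q x) (at x within {0..})" if "x \<ge> 0" for x
    using bdot_deriv[OF that, of "cvec n"] comps(1)[OF that] by (simp add: p_def[abs_def])
  moreover have "(q has_vector_derivative \<i> * of_real ((norm \<tau>)\<^sup>2) * p x) (at x within {0..})"
    if "x \<ge> 0" for x
    using bdot_deriv[OF that, of "cvec \<tau>"] comps(2)[OF that] by (simp add: q_def[abs_def])
  moreover have "(p \<longlongrightarrow> 0) at_top" "(q \<longlongrightarrow> 0) at_top"
    using bdot_lim by (simp_all add: p_def[abs_def] q_def[abs_def])
  moreover have "p 0 = 0"
    using v0 by (simp add: p_def bdot_def cvec_def)
  ultimately have pq: "p z = 0" "q z = 0"
    using decaying_solution_zero[of "norm \<tau>" p q z] \<tau> z by simp_all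
  show "v z = 0"
  proof (rule cross_dot_zero_imp_zero)
    show "bcross (bcross (cvec n) (cvec \<tau>)) (v z) = 0"
      using pq by (simp add: bcross_bcross_left p_def q_def)
    show "bdot (bcross (cvec n) (cvec \<tau>)) (v z) = 0"
      using comps(3) z by simp
    show "bdot (bcross (cvec n) (cvec \<tau>)) (bcross (cvec n) (cvec \<tau>)) \<noteq> 0"
      using n orth \<tau> by (simp add: bdot_bcross_bcross bdot_cvec_cvec inner_commute)
  qed
qed

theorem mainTheorem4:
  fixes G :: "(real^3) set" and l :: complex
  assumes "smooth_bounded_domain G"
    and "l \<noteq> 0"
  shows "solonnikov_elliptic l G"
  unfolding solonnikov_elliptic_def
  using solonnikov_interior_nonzero solonnikov_boundary_nonzero assms(2) by blast

end
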